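(* Let $\mathcal{L}=\{l_1, l_2, \dots, l_s\}$ be a set of $s$ nonnegative integers with $0 \leq l_{1} < l_{2} < \cdots < l_{s}$ and let $\mathbb{F}_{q}$ be a finite field of order $q$. Suppose that $\mathcal{V}$ is a Sperner family of subspaces of an $n$-dimensional vector space over $\mathbb{F}_{q}$ such that $\dim(V_{i} \cap V_{j}) \in \mathcal{L}$ for any distinct subspaces $V_{i}, V_{j}$ in $\mathcal{V}$. Let $k = \max_{V \in \mathcal{V}} \dim(V)$. If \[n \geq \max\left\{\log_{q}\left((q^{s}-1)\begin{bmatrix} k^{2} \\ l_{1} + 1 \end{bmatrix}_q + 1 \right) + l_{1},\; 2s + 1\right\},\] then \[|\mathcal{V}| \leq \begin{bmatrix} n \\ s\end{bmatrix}_q.\] Moreover, if $|\mathcal{V}| = \begin{bmatrix} n \\ s\end{bmatrix}_q$, then $\mathcal{L} = \{0, 1, \dots, s - 1\}$.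
   Context: A family $\mathcal{V}$ of subspaces is Sperner (an antichain) if no member of $\mathcal{V}$ is contained in another member of $\mathcal{V}$. For integers $n\ge k\ge 0$, the Gaussian binomial coefficient is $\begin{bmatrix} n \\ k\end{bmatrix}_q = \prod_{0 \leq i \leq k - 1}\frac{q^{n - i} - 1}{q^{k - i} - 1}$; it equals the number of $k$-dimensional subspaces of an $n$-dimensional vector space over $\mathbb{F}_q$. *)

theory Defs
  imports Complex_Main
begin

definition sperner_family :: "'a set set \<Rightarrow> bool" where
  "sperner_family F \<longleftrightarrow> (\<forall>A\<in>F. \<forall>B\<in>F. A \<noteq> B \<longrightarrow> \<not> A \<subseteq> B)"

(* For k > n the factor at i = n vanishes, so the value is 0, in accordance with the
   number of k-dimensional subspaces of an n-dimensional space. *)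
definition gaussian_binomial :: "nat \<Rightarrow> nat \<Rightarrow> nat \<Rightarrow> real" where
  "gaussian_binomial q n k = (\<Prod>i<k. (real q ^ (n - i) - 1) / (real q ^ (k - i) - 1))"

end

theory Submission
  imports Defs "HOL-Library.Function_Algebras"
begin

text \<open>
  For a Sperner family \<open>F\<close> with intersection dimensions in \<open>L\<close>, all of whose members contain a
  subspace \<open>T\<close>, the functions \<open>W \<mapsto> \<Prod>l\<in>L, l < dim V. (card (V \<inter> W) - q ^ l)\<close> with \<open>V \<in> F\<close> vanish off
  the diagonal and are combinations of the indicators of \<open>U \<subseteq> W\<close> with \<open>T \<subseteq> U\<close> and
  \<open>dim U \<le> dim T + card L\<close>. Hence \<open>card F\<close> is at most the sum of the Gaussian binomials
  \<open>[n - dim T, i]\<close> over \<open>i \<le> card L\<close>.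

  If \<open>L = {0..<s}\<close>, the bound \<open>[n, s]\<close> comes from choosing \<open>s\<close>-dimensional subspaces of the large
  members and pushing small members up through upper shadows. Otherwise some \<open>l \<in> L\<close> has \<open>l \<ge> s\<close> and
  the inequality is strict. If \<open>0 \<in> L\<close>, members of dimension at most \<open>s\<close> lose the intersection size
  \<open>l\<close>, and members of larger dimension are counted by their nonzero vectors, whose degrees lose the
  intersection size \<open>0\<close>. If \<open>0 \<notin> L\<close>, either a nonzero vector is common to all members, or at most
  \<open>q ^ (k * (l\<^sub>1 + 1))\<close> subspaces of dimension \<open>l\<^sub>1 + 1\<close> suffice to have one inside every member; each
  of these lies in few members because the intersection size \<open>l\<^sub>1\<close> is lost.\<close>

section \<open>Gaussian binomial coefficients\<close>

lemma gaussian_binomial_0 [simp]: "gaussian_binomial q n 0 = 1"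
  by (simp add: gaussian_binomial_def)

lemma gaussian_binomial_0_Suc [simp]: "gaussian_binomial q 0 (Suc k) = 0"
  by (auto simp: gaussian_binomial_def)

lemma power_minus_1_pos:
  fixes q :: nat
  assumes "q \<ge> 2" "j > 0"
  shows "real q ^ j - 1 > 0"
  using assms by (simp add: one_less_power)

text \<open>The absorption identity, in multiplied form because the double counts of incidences
  below produce exactly this shape.\<close>

lemma gaussian_binomial_Suc_Suc:
  assumes "q \<ge> 2"
  shows "gaussian_binomial q (Suc n) (Suc k) * (real q ^ Suc k - 1) =
    (real q ^ Suc n - 1) * gaussian_binomial q n k"
proof -
  have "real q ^ Suc k - 1 \<noteq> 0"
    using power_minus_1_pos[OF assms, of "Suc k"] by simp
  then show ?thesis
    unfolding gaussian_binomial_def by (subst prod.lessThan_Suc_shift) (simp add: field_simps)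
qed

lemma gaussian_binomial_Suc_right:
  assumes "q \<ge> 2"
  shows "gaussian_binomial q n (Suc k) * (real q ^ Suc k - 1) =
    gaussian_binomial q n k * (real q ^ (n - k) - 1)"
proof -
  have "real q ^ Suc k - 1 \<noteq> 0"
    using power_minus_1_pos[OF assms, of "Suc k"] by simp
  moreover have "(\<Prod>i<Suc k. real q ^ (Suc k - i) - 1) =
      (real q ^ Suc k - 1) * (\<Prod>i<k. real q ^ (k - i) - 1)"
    by (subst prod.lessThan_Suc_shift) simp
  ultimately show ?thesis
    unfolding gaussian_binomial_def prod_dividef by simp
qed

text \<open>Each of the \<open>k\<close> factors is at least \<open>q ^ (n - k)\<close>, because
  \<open>q ^ (n - i)\<close> equals \<open>q ^ (n - k) * q ^ (k - i)\<close>.\<close>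

lemma gaussian_binomial_ge_power:
  assumes "q \<ge> 2" "k \<le> n"
  shows "gaussian_binomial q n k \<ge> real q ^ (k * (n - k))"
proof -
  have "real q ^ (n - k) \<le> (real q ^ (n - i) - 1) / (real q ^ (k - i) - 1)" if "i < k" for i
  proof -
    have "real q ^ (n - k) \<ge> 1" using assms by simp
    moreover have "real q ^ (n - i) = real q ^ (n - k) * real q ^ (k - i)"
      using that assms by (simp flip: power_add)
    ultimately show ?thesis
      using power_minus_1_pos[OF assms(1), of "k - i"] that
      by (simp add: pos_le_divide_eq algebra_simps)
  qed
  then have "(\<Prod>i<k. real q ^ (n - k)) \<le> gaussian_binomial q n k"
    unfolding gaussian_binomial_def by (intro prod_mono) auto
  then show ?thesis by (simp add: mult.commute flip: power_mult)
qed

lemma gaussian_binomial_ge_1: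
  assumes "q \<ge> 2" "k \<le> n"
  shows "gaussian_binomial q n k \<ge> 1"
proof -
  have "1 \<le> real q ^ (k * (n - k))" using assms by simp
  then show ?thesis using gaussian_binomial_ge_power[OF assms] by linarith
qed

lemma gaussian_binomial_nonneg:
  assumes "q \<ge> 2"
  shows "gaussian_binomial q n k \<ge> 0"
proof -
  have "1 \<le> real q ^ j" for j using assms by simp
  then show ?thesis
    unfolding gaussian_binomial_def by (auto intro!: prod_nonneg divide_nonneg_nonneg)
qed

lemma gaussian_binomial_Suc_left:
  assumes "q \<ge> 2" "k \<le> n"
  shows "gaussian_binomial q (Suc n) k * (real q ^ (Suc n - k) - 1) =
    gaussian_binomial q n k * (real q ^ Suc n - 1)"
proof (cases k)
  case (Suc j)
  have "real q ^ Suc j - 1 \<noteq> 0"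
    using power_minus_1_pos[OF assms(1), of "Suc j"] by simp
  moreover have "gaussian_binomial q (Suc n) (Suc j) * (real q ^ (n - j) - 1) * (real q ^ Suc j - 1) =
      gaussian_binomial q n (Suc j) * (real q ^ Suc n - 1) * (real q ^ Suc j - 1)"
    using gaussian_binomial_Suc_Suc[OF assms(1), of n j]
      gaussian_binomial_Suc_right[OF assms(1), of n j] by (metis mult.assoc mult.commute)
  ultimately show ?thesis using Suc by simp
qed simp

text \<open>The quotient of the two coefficients is
  \<open>(q ^ Suc n - 1) / (q ^ (Suc n - k) - 1)\<close>, which exceeds
  \<open>q ^ k\<close>.\<close>

lemma gaussian_binomial_double_left:
  assumes "q \<ge> 2" "1 \<le> k" "k \<le> n"
  shows "2 * gaussian_binomial q n k < gaussian_binomial q (Suc n) k"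
proof -
  let ?a = "real q ^ (Suc n - k)"
  have a: "?a - 1 > 0" using power_minus_1_pos assms by simp
  have "real q ^ Suc n = ?a * real q ^ k"
    using assms by (simp flip: power_add)
  moreover have "real q ^ k \<ge> 2"
    using assms self_le_power[of "real q" k] by linarith
  ultimately have "real q ^ Suc n \<ge> ?a * 2" using a by (simp add: mult_left_mono)
  then have "2 * (?a - 1) < real q ^ Suc n - 1" by simp
  then have "gaussian_binomial q n k * (2 * (?a - 1)) < gaussian_binomial q n k * (real q ^ Suc n - 1)"
    using gaussian_binomial_ge_1[of q k n] assms by (intro mult_strict_left_mono) auto
  also have "\<dots> = gaussian_binomial q (Suc n) k * (?a - 1)"
    using gaussian_binomial_Suc_left[of q k n] assms by simp
  finally have "2 * gaussian_binomial q n k * (?a - 1) < gaussian_binomial q (Suc n) k * (?a - 1)"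
    by (simp add: algebra_simps)
  then show ?thesis using a by (simp only: mult_less_cancel_right_pos)
qed

lemma gaussian_binomial_mono_left:
  assumes "q \<ge> 2" "1 \<le> k" "k \<le> m" "m \<le> n"
  shows "gaussian_binomial q m k \<le> gaussian_binomial q n k"
  using assms(4)
proof (induction n rule: dec_induct)
  case (step n)
  then show ?case
    using gaussian_binomial_double_left[of q k n] gaussian_binomial_nonneg[of q n k] assms by simp
qed simp

text \<open>The quotient is \<open>(q ^ (n - k) - 1) / (q ^ Suc k - 1)\<close>, and the exponents
  differ by at least \<open>c\<close>.\<close>

lemma gaussian_binomial_ratio:
  assumes "q \<ge> 2" "2 * k + 1 + c \<le> n"
  shows "2 ^ c * gaussian_binomial q n k \<le> gaussian_binomial q n (Suc k)"
proof -
  let ?b = "real q ^ Suc k"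
  have b: "?b - 1 > 0" using power_minus_1_pos assms by blast
  have c: "(2::real) ^ c \<le> real q ^ c" "(1::real) \<le> 2 ^ c"
    using assms by (auto intro: power_mono)
  have "2 ^ c * (?b - 1) \<le> 2 ^ c * ?b - 1" using c by (simp add: algebra_simps)
  also have "\<dots> \<le> real q ^ c * ?b - 1" using c b by (intro diff_right_mono mult_right_mono) auto
  also have "\<dots> = real q ^ (c + Suc k) - 1" by (simp add: power_add)
  also have "\<dots> \<le> real q ^ (n - k) - 1"
    using assms by (intro diff_right_mono power_increasing) auto
  finally have "gaussian_binomial q n k * (2 ^ c * (?b - 1)) \<le>
      gaussian_binomial q n (Suc k) * (?b - 1)"
    unfolding gaussian_binomial_Suc_right[OF assms(1)]
    using gaussian_binomial_nonneg[OF assms(1)] by (intro mult_left_mono) auto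
  then have "2 ^ c * gaussian_binomial q n k * (?b - 1) \<le> gaussian_binomial q n (Suc k) * (?b - 1)"
    by (simp add: mult_ac)
  then show ?thesis using b by (simp only: mult_le_cancel_right_pos)
qed

lemma gaussian_binomial_mono_right:
  assumes "q \<ge> 2" "i \<le> j" "2 * j \<le> n"
  shows "gaussian_binomial q n i \<le> gaussian_binomial q n j"
  using assms(2,3)
proof (induction j rule: dec_induct)
  case (step j)
  then show ?case using gaussian_binomial_ratio[of q j 0 n] assms(1) by simp
qed simp

text \<open>Up to index \<open>s\<close> each coefficient is at least \<open>2 ^ c\<close> times the
  previous one, so a geometric series bounds the sum. The instances \<open>c = 1\<close> and
  \<open>c = 2\<close> give the constants 2 and 4/3.\<close>

lemma sum_gaussian_binomial_le:
  assumes "q \<ge> 2" "2 * s + c \<le> n + 1"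
  shows "(2 ^ c - 1) * (\<Sum>i\<le>s. gaussian_binomial q n i) \<le> 2 ^ c * gaussian_binomial q n s"
  using assms(2)
proof (induction s)
  case (Suc s)
  then show ?case
    using gaussian_binomial_ratio[of q s c n] assms(1) by (simp add: algebra_simps)
qed simp

lemma gaussian_binomial_hyperplanes:
  assumes "q \<ge> 2"
  shows "gaussian_binomial q (Suc d) d * (real q - 1) = real q ^ Suc d - 1"
proof (induction d)
  case (Suc d)
  have "real q ^ Suc d - 1 \<noteq> 0"
    using power_minus_1_pos[OF assms, of "Suc d"] by simp
  moreover have "gaussian_binomial q (Suc (Suc d)) (Suc d) * (real q - 1) * (real q ^ Suc d - 1) =
     (real q ^ Suc (Suc d) - 1) * (real q ^ Suc d - 1)"
    using Suc.IH gaussian_binomial_Suc_Suc[OF assms, of "Suc d" d] by (metis mult.assoc mult.commute)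
  ultimately show ?case by simp
qed simp

text \<open>The numerical form of the logarithmic condition on \<open>n\<close>: a number of
  covering subspaces times a bound on the members through each. Absorption turns
  \<open>large\<close> into a bound of \<open>?K\<close> times \<open>[m, s - 1]\<close> by
  \<open>[m + 1, s]\<close>; the factor 2 lost in the sum is regained on passing from
  \<open>n - 1\<close> to \<open>n\<close>.\<close>

lemma cover_count_less_gaussian_binomial:
  assumes "q \<ge> 2" "1 \<le> a" "a < k" "1 \<le> s" "s \<le> k - a" "a \<le> n"
    and large: "(real q ^ s - 1) * gaussian_binomial q (k\<^sup>2) (a + 1) \<le> real q ^ (n - a) - 1"
  shows "real q ^ (k * (a + 1)) * (\<Sum>i\<le>s - 1. gaussian_binomial q (n - (a + 1)) i) < gaussian_binomial q n s"
proof -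
  define m where "m = n - (a + 1)"
  define e where "e = (a + 1) * (k\<^sup>2 - (a + 1))"
  let ?K = "gaussian_binomial q (k\<^sup>2) (a + 1)"
  \<comment> \<open>Here \<open>k \<ge> 2\<close>, since \<open>1 \<le> a < k\<close>. With
    \<open>a + 1 \<le> k\<close> this leaves room for \<open>k\<close> below
    \<open>k\<^sup>2 - (a + 1)\<close>, so \<open>?K\<close> dominates the number of covering
    subspaces.\<close>
  have "2 * k \<le> k\<^sup>2" using assms by (simp add: power2_eq_square)
  then have "k \<le> k\<^sup>2 - (a + 1)" "a + 1 \<le> k\<^sup>2" using assms by linarith+
  then have K: "?K \<ge> real q ^ e" and ke: "k * (a + 1) \<le> e"
    using gaussian_binomial_ge_power[of q "a + 1" "k\<^sup>2"] assms
      mult_le_mono2[of k "k\<^sup>2 - (a + 1)" "a + 1"]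
    by (simp_all only: e_def mult.commute)
  have s1: "real q ^ s - 1 > 0" using power_minus_1_pos assms by simp
  \<comment> \<open>Comparing powers of \<open>q\<close> in \<open>large\<close> yields
    \<open>s - 1 + e < n - a\<close>. Hence \<open>m\<close> is at least \<open>2 * s\<close>, the
    range in which the coefficients still grow.\<close>
  have "real q ^ s = real q * real q ^ (s - 1)" using assms by (simp flip: power_Suc)
  moreover have "real q * real q ^ (s - 1) \<ge> 2 * real q ^ (s - 1)"
    using assms by (intro mult_right_mono) auto
  moreover have "real q ^ (s - 1) \<ge> 1" using assms by simp
  ultimately have "real q ^ (s - 1) \<le> real q ^ s - 1" by linarith
  then have "real q ^ (s - 1) * real q ^ e \<le> (real q ^ s - 1) * ?K"
    using K s1 by (intro mult_mono) auto
  then have "real q ^ (s - 1 + e) < real q ^ (n - a)" using large by (simp add: power_add)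
  then have "s - 1 + e < n - a" using assms by (simp add: power_less_imp_less_exp)
  moreover have "2 * k \<le> k * (a + 1)" using assms by simp
  ultimately have m: "n - a = Suc m" "2 * s \<le> m" "Suc m \<le> n - 1"
    using ke assms unfolding m_def by linarith+
  have sum: "(\<Sum>i\<le>s - 1. gaussian_binomial q m i) \<le> 2 * gaussian_binomial q m (s - 1)"
    using sum_gaussian_binomial_le[of q "s - 1" 1 m] assms m by simp
  have "?K * gaussian_binomial q m (s - 1) * (real q ^ s - 1) \<le>
      (real q ^ Suc m - 1) * gaussian_binomial q m (s - 1)"
    using mult_right_mono[OF large, of "gaussian_binomial q m (s - 1)"]
      gaussian_binomial_nonneg[of q m "s - 1"] assms m by (simp add: mult_ac)
  also have "\<dots> = gaussian_binomial q (Suc m) s * (real q ^ s - 1)"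
    using gaussian_binomial_Suc_Suc[of q m "s - 1"] assms by simp
  finally have "?K * gaussian_binomial q m (s - 1) \<le> gaussian_binomial q (Suc m) s"
    using s1 by (simp only: mult_le_cancel_right_pos)
  also have "\<dots> \<le> gaussian_binomial q (n - 1) s"
    using assms m by (intro gaussian_binomial_mono_left) auto
  finally have "2 * (?K * gaussian_binomial q m (s - 1)) < gaussian_binomial q n s"
    using gaussian_binomial_double_left[of q s "n - 1"] assms m by simp
  moreover have "real q ^ (k * (a + 1)) \<le> ?K"
    using K power_increasing[OF ke, of "real q"] assms(1) by linarith
  then have "real q ^ (k * (a + 1)) * (\<Sum>i\<le>s - 1. gaussian_binomial q m i) \<le>
      ?K * (2 * gaussian_binomial q m (s - 1))"
    using sum gaussian_binomial_nonneg[of q] assms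
    by (intro mult_mono sum_nonneg) auto
  ultimately show ?thesis unfolding m_def by linarith
qed

lemma sperner_family_subset: "sperner_family F \<Longrightarrow> G \<subseteq> F \<Longrightarrow> sperner_family G"
  unfolding sperner_family_def by blast

section \<open>The polynomial method\<close>

text \<open>Real functions with pointwise scaling; their zero and addition are the pointwise ones of
  the function algebra.\<close>

interpretation real_fun: vector_space "\<lambda>(c::real) (f :: 'a \<Rightarrow> real) x. c * f x"
  by unfold_locales (auto simp: algebra_simps)

lemma sum_fun_apply: "(\<Sum>i\<in>A. f i) x = (\<Sum>i\<in>A. f i x)" for f :: "'b \<Rightarrow> 'a \<Rightarrow> real"
  by (induction A rule: infinite_finite_induct) auto

text \<open>The matrix of values \<open>f v w\<close> is diagonal with nonzero diagonal, so the
  functions are linearly independent, and independent vectors in the span of \<open>G\<close> number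
  at most \<open>card G\<close>.\<close>

lemma card_le_diagonal_functions:
  fixes f :: "'a \<Rightarrow> 'a \<Rightarrow> real"
  assumes "finite F" "finite G"
    and span: "\<And>v. v \<in> F \<Longrightarrow> f v \<in> real_fun.span G"
    and diag: "\<And>v. v \<in> F \<Longrightarrow> f v v \<noteq> 0"
    and off_diag: "\<And>v w. v \<in> F \<Longrightarrow> w \<in> F \<Longrightarrow> v \<noteq> w \<Longrightarrow> f v w = 0"
  shows "card F \<le> card G"
proof -
  have inj: "inj_on f F" by (metis diag off_diag inj_onI)
  have "real_fun.independent (f ` F)"
  proof (rule real_fun.independent_if_scalars_zero)
    fix u g assume 0: "(\<Sum>g\<in>f ` F. (\<lambda>x. u g * g x)) = 0" and "g \<in> f ` F"
    then obtain w where w: "w \<in> F" "g = f w" by auto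
    have "0 = (\<Sum>v\<in>F. u (f v) * f v w)"
      using fun_cong[OF 0, of w] inj by (simp add: sum_fun_apply sum.reindex)
    also have "\<dots> = (\<Sum>v\<in>F. if v = w then u g * g w else 0)"
      using w off_diag by (intro sum.cong) auto
    finally show "u g = 0" using w diag \<open>finite F\<close> by simp
  qed (use \<open>finite F\<close> in simp)
  then show ?thesis
    using real_fun.independent_span_bound[OF \<open>finite G\<close>, of "f ` F"] span inj by (auto simp: card_image)
qed

section \<open>Counting vectors and subspaces over a finite field\<close>

locale finite_field_vector_space = finite_dimensional_vector_space scale Basis
  for scale :: "'f::{field,finite} \<Rightarrow> 'v::ab_group_add \<Rightarrow> 'v" (infixr "*s" 75) and Basis +
  fixes q :: nat
  assumes q_def: "q = card (UNIV :: 'f set)"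
begin

lemma q_ge_2: "q \<ge> 2"
proof -
  have "card {0::'f, 1} \<le> q" unfolding q_def by (intro card_mono) auto
  then show ?thesis by simp
qed

text \<open>Each new basis vector \<open>b\<close> adds one free coordinate:
  \<open>(c, v) \<mapsto> c *s b + v\<close> is a bijection onto the larger span.\<close>

lemma card_span_independent:
  assumes "finite B" "independent B"
  shows "finite (span B) \<and> card (span B) = q ^ card B"
  using assms
proof (induction B)
  case (insert b B)
  have ind: "b \<notin> span B" "independent B"
    using insert.prems insert.hyps by (auto simp: independent_insert)
  let ?h = "\<lambda>(c, v). c *s b + v"
  have inj: "inj_on ?h (UNIV \<times> span B)"
  proof (rule inj_onI; clarify)
    fix c d v w
    assume v: "v \<in> span B" "w \<in> span B" and eq: "c *s b + v = d *s b + w"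
    have "(c - d) *s b = w - v" using eq by (simp add: scale_left_diff_distrib algebra_simps)
    then have "(c - d) *s b \<in> span B" using v by (simp add: span_diff)
    then have "inverse (c - d) *s (c - d) *s b \<in> span B" by (rule span_scale)
    then have "c = d" using ind(1) by (cases "c - d = 0") auto
    then show "c = d \<and> v = w" using eq by simp
  qed
  have im: "span (insert b B) = ?h ` (UNIV \<times> span B)"
  proof (intro equalityI subsetI)
    fix x assume "x \<in> span (insert b B)"
    then obtain c where "x - c *s b \<in> span B" by (auto simp: span_insert)
    then show "x \<in> ?h ` (UNIV \<times> span B)"
      by (intro image_eqI[of _ _ "(c, x - c *s b)"]) auto
  next
    fix x assume "x \<in> ?h ` (UNIV \<times> span B)"
    then obtain c v where x: "x = c *s b + v" and "v \<in> span B" by auto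
    then have "x - c *s b \<in> span B" by simp
    then show "x \<in> span (insert b B)" by (auto simp: span_insert)
  qed
  show ?case
    unfolding im using insert ind inj by (simp add: card_image card_cartesian_product q_def)
qed simp

lemma finite_vectors [simp]: "finite (A :: 'v set)"
  using card_span_independent[OF finite_Basis independent_Basis] span_Basis
  by (auto intro: finite_subset[OF subset_UNIV])

lemma finite_vector_sets [simp]: "finite (A :: 'v set set)"
  by (rule finite_subset[of A "Pow UNIV"]) (simp, simp only: finite_Pow_iff finite_vectors)

lemma card_subspace:
  assumes "subspace V"
  shows "card V = q ^ dim V"
proof -
  obtain B where "finite B" "B \<subseteq> V" "independent B" "span B = V" "card B = dim V"
    using assms by (rule basis_subspace_exists)
  then show ?thesis using card_span_independent[of B] by simp
qed

lemma dim_span_insert: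
  assumes "subspace T" "x \<notin> T"
  shows "dim (span (insert x T)) = Suc (dim T)"
proof -
  have "x \<notin> span T" using assms span_eq_iff by metis
  then show ?thesis by (simp add: dim_insert)
qed

lemma span_insert_subset_iff:
  assumes "subspace U"
  shows "span (insert x T) \<subseteq> U \<longleftrightarrow> x \<in> U \<and> T \<subseteq> U"
  using assms span_minimal[of "insert x T" U] span_superset[of "insert x T"] by auto

text \<open>These stand for the \<open>i\<close>-dimensional subspaces of the quotient of
  \<open>X\<close> by \<open>T\<close>, without forming the quotient.\<close>

definition subspaces_between :: "'v set \<Rightarrow> 'v set \<Rightarrow> nat \<Rightarrow> 'v set set" where
  "subspaces_between T X i = {U. subspace U \<and> T \<subseteq> U \<and> U \<subseteq> X \<and> dim U = dim T + i}"

text \<open>Double count of pairs of a vector \<open>x\<close> in \<open>X - T\<close> and a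
  subspace \<open>U\<close> containing it. The subspaces through \<open>x\<close> lie above
  \<open>span (insert x T)\<close>, so the induction needs \<open>T\<close> arbitrary.\<close>

lemma card_subspaces_between:
  assumes "subspace T" "subspace X" "T \<subseteq> X"
  shows "real (card (subspaces_between T X i)) = gaussian_binomial q (dim X - dim T) i"
  using assms
proof (induction i arbitrary: T)
  case 0
  have "U = T" if "U \<in> subspaces_between T X 0" for U
    using that 0 subspace_dim_equal[of T U] by (simp add: subspaces_between_def)
  then have "subspaces_between T X 0 = {T}"
    using 0 by (auto simp: subspaces_between_def)
  then show ?case by simp
next
  case (Suc i)
  note T = Suc.prems
  have TX: "dim T \<le> dim X" using T by (intro dim_subset)
  show ?case
  proof (cases "dim T = dim X")
    case True
    have "U \<notin> subspaces_between T X (Suc i)" for U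
      using True dim_subset[of U X] by (auto simp: subspaces_between_def)
    then have "subspaces_between T X (Suc i) = {}" by blast
    then show ?thesis using True by simp
  next
    case False
    then obtain m where m: "dim X - dim T = Suc m" using TX by (cases "dim X - dim T") auto
    let ?S = "subspaces_between T X (Suc i)"
    have deg: "real (card {U \<in> ?S. x \<in> U}) = gaussian_binomial q m i" if x: "x \<in> X - T" for x
    proof -
      let ?T = "span (insert x T)"
      have d: "dim ?T = Suc (dim T)" using x T dim_span_insert by auto
      have "U \<in> ?S \<and> x \<in> U \<longleftrightarrow> U \<in> subspaces_between ?T X i" for U
        using span_insert_subset_iff[of U x T] d unfolding subspaces_between_def by fastforce
      then have "{U \<in> ?S. x \<in> U} = subspaces_between ?T X i" by blast
      moreover have "?T \<subseteq> X" using x T by (simp add: span_insert_subset_iff)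
      moreover have "dim X - dim ?T = m" using d m by simp
      ultimately show ?thesis using Suc.IH[of ?T] T by simp
    qed
    have cU: "real (card {x \<in> X - T. x \<in> U}) = real q ^ dim T * (real q ^ Suc i - 1)" if "U \<in> ?S" for U
    proof -
      have U: "subspace U" "T \<subseteq> U" "U \<subseteq> X" "dim U = dim T + Suc i"
        using that by (auto simp: subspaces_between_def)
      have "{x \<in> X - T. x \<in> U} = U - T" using U by auto
      moreover have "card T \<le> card U" using U by (intro card_mono) auto
      ultimately show ?thesis using U T
        by (simp add: card_Diff_subset of_nat_diff card_subspace power_add algebra_simps)
    qed
    have "card T \<le> card X" using T by (intro card_mono) auto
    have cX: "real (card (X - T)) = real q ^ dim T * (real q ^ Suc m - 1)"
    proof -
      have "dim X = dim T + Suc m" using m TX by linarith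
      then show ?thesis using T \<open>card T \<le> card X\<close>
        by (simp add: card_Diff_subset of_nat_diff card_subspace power_add algebra_simps)
    qed
    have "(\<Sum>U\<in>?S. real (card {x \<in> X - T. x \<in> U})) = (\<Sum>x\<in>X - T. real (card {U \<in> ?S. x \<in> U}))"
      using sum.swap_restrict[of ?S "X - T" "\<lambda>_ _. 1::real" "\<lambda>U x. x \<in> U"]
      by simp
    moreover have "(\<Sum>U\<in>?S. real (card {x \<in> X - T. x \<in> U})) =
        real q ^ dim T * (real (card ?S) * (real q ^ Suc i - 1))"
      using sum.cong[OF refl cU, of ?S] by (simp only: sum_constant mult_ac)
    moreover have "(\<Sum>x\<in>X - T. real (card {U \<in> ?S. x \<in> U})) =
        real q ^ dim T * ((real q ^ Suc m - 1) * gaussian_binomial q m i)"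
      using sum.cong[OF refl deg, of "X - T"] by (simp only: sum_constant cX mult_ac)
    ultimately have "real q ^ dim T * (real (card ?S) * (real q ^ Suc i - 1)) =
        real q ^ dim T * ((real q ^ Suc m - 1) * gaussian_binomial q m i)"
      by metis
    then have "real (card ?S) * (real q ^ Suc i - 1) = gaussian_binomial q (Suc m) (Suc i) * (real q ^ Suc i - 1)"
      using gaussian_binomial_Suc_Suc[OF q_ge_2, of m i] q_ge_2 by simp
    then show ?thesis
      using power_minus_1_pos[OF q_ge_2, of "Suc i"] m by (simp del: power_Suc)
  qed
qed

lemma card_superspaces_dim_le:
  assumes "subspace T"
  shows "real (card {U. subspace U \<and> T \<subseteq> U \<and> dim U \<le> dim T + j}) =
    (\<Sum>i\<le>j. gaussian_binomial q (dim UNIV - dim T) i)"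
proof -
  have "{U. subspace U \<and> T \<subseteq> U \<and> dim U \<le> dim T + j} = (\<Union>i\<le>j. subspaces_between T UNIV i)"
    (is "?A = ?B")
  proof (intro equalityI subsetI)
    fix U assume U: "U \<in> ?A"
    then have "U \<in> subspaces_between T UNIV (dim U - dim T)" "dim U - dim T \<le> j"
      using dim_subset[of T U] by (auto simp: subspaces_between_def)
    then show "U \<in> ?B" by blast
  qed (auto simp: subspaces_between_def)
  also have "card \<dots> = (\<Sum>i\<le>j. card (subspaces_between T UNIV i))"
    by (intro card_UN_disjoint) (auto simp: subspaces_between_def)
  finally show ?thesis
    using assms by (simp add: card_subspaces_between del: dim_UNIV)
qed

text \<open>Setting the value to 0 on sets that are not subspaces makes the product identity below
  hold for every argument \<open>W\<close>.\<close>

definition superspace_indicator :: "'v set \<Rightarrow> 'v set \<Rightarrow> real" where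
  "superspace_indicator U W = (if subspace W \<and> U \<subseteq> W then 1 else 0)"

text \<open>The bound \<open>j\<close> acts as a degree: it rises by one with each factor of the
  product.\<close>

definition superspace_indicators :: "'v set \<Rightarrow> nat \<Rightarrow> ('v set \<Rightarrow> real) set" where
  "superspace_indicators T j =
    superspace_indicator ` {U. subspace U \<and> T \<subseteq> U \<and> dim U \<le> dim T + j}"

text \<open>\<open>card (V \<inter> W)\<close> sums the indicators of \<open>x \<in> W\<close> over
  \<open>x \<in> V\<close>, and a subspace contains both \<open>x\<close> and \<open>U\<close>
  exactly when it contains their span.\<close>

lemma superspace_indicator_mult:
  "superspace_indicator U W * (real (card (V \<inter> W)) - c) =
    (\<Sum>x\<in>V. superspace_indicator (span (insert x U)) W) - c * superspace_indicator U W"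
proof (cases "subspace W \<and> U \<subseteq> W")
  case True
  then have "superspace_indicator (span (insert x U)) W = of_bool (x \<in> W)" for x
    by (simp add: superspace_indicator_def span_insert_subset_iff)
  then show ?thesis using True
    by (simp add: superspace_indicator_def sum.If_cases of_bool_def Int_def)
next
  case False
  then have "superspace_indicator (span (insert x U)) W = 0" for x
    by (auto simp: superspace_indicator_def span_insert_subset_iff)
  moreover have "superspace_indicator U W = 0"
    using False by (simp add: superspace_indicator_def)
  ultimately show ?thesis by simp
qed

lemma span_superspace_indicators_mult:
  assumes "g \<in> real_fun.span (superspace_indicators T j)"
  shows "(\<lambda>W. g W * (real (card (V \<inter> W)) - c)) \<in> real_fun.span (superspace_indicators T (Suc j))"
  using assms
proof (induction rule: real_fun.span_induct_alt)
  case base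
  have "(\<lambda>W::'v set. (0 :: 'v set \<Rightarrow> real) W * (real (card (V \<inter> W)) - c)) = 0" by auto
  then show ?case by (simp only: real_fun.span_zero)
next
  case (step a u g)
  obtain U where U: "u = superspace_indicator U" "subspace U" "T \<subseteq> U" "dim U \<le> dim T + j"
    using step.hyps by (auto simp: superspace_indicators_def)
  have 1: "superspace_indicator (span (insert x U)) \<in> superspace_indicators T (Suc j)" for x
  proof -
    have "T \<subseteq> span (insert x U)" using U(3) span_superset[of "insert x U"] by blast
    moreover have "dim (span (insert x U)) \<le> dim T + Suc j" using U(4) by (simp add: dim_insert)
    ultimately show ?thesis unfolding superspace_indicators_def by simp
  qed
  have 2: "superspace_indicator U \<in> superspace_indicators T (Suc j)"
    unfolding superspace_indicators_def using U by auto
  have "(\<lambda>W. ((\<lambda>x. a * u x) + g) W * (real (card (V \<inter> W)) - c)) =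
      (\<lambda>W. a * ((\<Sum>x\<in>V. superspace_indicator (span (insert x U))) - (\<lambda>W. c * superspace_indicator U W)) W)
      + (\<lambda>W. g W * (real (card (V \<inter> W)) - c))"
    unfolding U
    by (intro ext) (simp add: sum_fun_apply distrib_right mult.assoc superspace_indicator_mult)
  moreover have "(\<lambda>W. a * ((\<Sum>x\<in>V. superspace_indicator (span (insert x U)))
      - (\<lambda>W. c * superspace_indicator U W)) W) \<in> real_fun.span (superspace_indicators T (Suc j))"
    using 1 2
    by (intro real_fun.span_scale real_fun.span_diff real_fun.span_sum real_fun.span_base)
  ultimately show ?case
    using step.IH real_fun.span_add by simp
qed

lemma prod_in_span_superspace_indicators:
  assumes "subspace T" "finite A"
  shows "(\<lambda>W. superspace_indicator T W * (\<Prod>a\<in>A. real (card (V \<inter> W)) - c a))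
    \<in> real_fun.span (superspace_indicators T (card A))"
  using assms(2)
proof (induction A)
  case empty
  have "superspace_indicator T \<in> superspace_indicators T 0"
    using assms(1) by (simp add: superspace_indicators_def)
  then show ?case by (simp add: real_fun.span_base)
next
  case (insert a A)
  then show ?case
    using span_superspace_indicators_mult[OF insert.IH, of V "c a"] by (simp add: mult_ac)
qed

lemma span_superspace_indicators_mono:
  "i \<le> j \<Longrightarrow> real_fun.span (superspace_indicators T i) \<subseteq> real_fun.span (superspace_indicators T j)"
  by (intro real_fun.span_mono) (auto simp: superspace_indicators_def)

lemma dim_Int_less:
  assumes "subspace V" "subspace W" "\<not> V \<subseteq> W"
  shows "dim (V \<inter> W) < dim V"
proof (rule ccontr)
  assume "\<not> dim (V \<inter> W) < dim V"
  then have "V \<inter> W = V"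
    using assms by (intro subspace_dim_equal subspace_inter) auto
  then show False using assms by blast
qed

theorem card_intersecting_family_le:
  assumes sub: "\<And>V. V \<in> F \<Longrightarrow> subspace V" and T: "subspace T" "\<And>V. V \<in> F \<Longrightarrow> T \<subseteq> V"
    and sperner: "sperner_family F" and "finite L"
    and inter: "\<And>V W. V \<in> F \<Longrightarrow> W \<in> F \<Longrightarrow> V \<noteq> W \<Longrightarrow> dim (V \<inter> W) \<in> L"
  shows "real (card F) \<le> (\<Sum>i\<le>card L. gaussian_binomial q (dim UNIV - dim T) i)"
proof -
  \<comment> \<open>Only sizes below \<open>dim V\<close> enter, which keeps \<open>f V V\<close>
    nonzero. The Sperner property makes \<open>dim (V \<inter> W)\<close> such a size whenever
    \<open>W \<noteq> V\<close>, so one factor vanishes.\<close>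
  define f where "f V W = superspace_indicator T W *
    (\<Prod>l\<in>{l \<in> L. l < dim V}. real (card (V \<inter> W)) - real q ^ l)" for V W
  have "card F \<le> card (superspace_indicators T (card L))"
  proof (rule card_le_diagonal_functions[where f = f])
    show "finite (superspace_indicators T (card L))"
      by (simp add: superspace_indicators_def)
    fix V assume V: "V \<in> F"
    have "card {l \<in> L. l < dim V} \<le> card L"
      using \<open>finite L\<close> by (intro card_mono) auto
    then show "f V \<in> real_fun.span (superspace_indicators T (card L))"
      using prod_in_span_superspace_indicators[OF T(1), of "{l \<in> L. l < dim V}" V "\<lambda>l. real q ^ l"]
        span_superspace_indicators_mono[of "card {l \<in> L. l < dim V}" "card L" T] \<open>finite L\<close>
      unfolding f_def by auto
    have "real q ^ dim V - real q ^ l \<noteq> 0" if "l < dim V" for l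
      using power_strict_increasing[OF that, of "real q"] q_ge_2 by simp
    then show "f V V \<noteq> 0"
      using V T sub \<open>finite L\<close> by (simp add: f_def superspace_indicator_def card_subspace)
    fix W assume W: "W \<in> F" "V \<noteq> W"
    then have "dim (V \<inter> W) < dim V"
      using V W sperner sub by (intro dim_Int_less) (auto simp: sperner_family_def)
    moreover have "card (V \<inter> W) = q ^ dim (V \<inter> W)"
      using V W sub by (intro card_subspace subspace_inter) auto
    ultimately show "f V W = 0"
      using inter[OF V W] \<open>finite L\<close> unfolding f_def by (auto intro!: prod_zero)
  qed simp
  also have "\<dots> \<le> card {U. subspace U \<and> T \<subseteq> U \<and> dim U \<le> dim T + card L}"
    unfolding superspace_indicators_def by (intro card_image_le) simp
  finally show ?thesis
    using card_superspaces_dim_le[OF T(1), of "card L"] by linarith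
qed

section \<open>Families of subspaces\<close>

lemma zero_subset_subspace: "subspace V \<Longrightarrow> {0} \<subseteq> V"
  by (simp add: subspace_0)

lemma subspace_of_dim_exists:
  assumes "subspace V" "d \<le> dim V"
  obtains U where "subspace U" "U \<subseteq> V" "dim U = d"
proof -
  have "real (card (subspaces_between {0} V d)) \<ge> 1"
    using assms gaussian_binomial_ge_1[OF q_ge_2, of d "dim V"] card_subspaces_between[of "{0}" V d]
      zero_subset_subspace by simp
  then have "subspaces_between {0} V d \<noteq> {}" by auto
  then show ?thesis using that by (auto simp: subspaces_between_def)
qed

text \<open>Double count of inclusions: every \<open>A\<close> has
  \<open>(q ^ (n - d) - 1) / (q - 1)\<close> superspaces one dimension higher, with
  \<open>n = dim UNIV\<close>, and every \<open>B\<close> contains at most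
  \<open>(q ^ Suc d - 1) / (q - 1)\<close> members. The condition \<open>d\<close> makes the first
  number at least the second.\<close>

lemma card_upper_shadow_ge:
  assumes F: "\<And>A. A \<in> F \<Longrightarrow> subspace A" "\<And>A. A \<in> F \<Longrightarrow> dim A = d"
    and d: "2 * d + 1 \<le> dim UNIV"
  shows "card F \<le> card {B. subspace B \<and> dim B = Suc d \<and> (\<exists>A\<in>F. A \<subseteq> B)}"
    (is "_ \<le> card ?S")
proof -
  let ?n = "dim UNIV"
  have up: "real (card {B \<in> ?S. A \<subseteq> B}) * (real q - 1) = real q ^ (?n - d) - 1" if A: "A \<in> F" for A
  proof -
    have "{B \<in> ?S. A \<subseteq> B} = subspaces_between A UNIV 1"
      using A F by (auto simp: subspaces_between_def)
    then have "real (card {B \<in> ?S. A \<subseteq> B}) = gaussian_binomial q (?n - d) (Suc 0)"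
      using card_subspaces_between[of A UNIV 1] A F by simp
    then show ?thesis
      using gaussian_binomial_Suc_right[OF q_ge_2, of "?n - d" 0] by simp
  qed
  have down: "real (card {A \<in> F. A \<subseteq> B}) * (real q - 1) \<le> real q ^ Suc d - 1" if B: "B \<in> ?S" for B
  proof -
    have "card {A \<in> F. A \<subseteq> B} \<le> card (subspaces_between {0} B d)"
      using F zero_subset_subspace by (intro card_mono) (auto simp: subspaces_between_def)
    moreover have "real (card (subspaces_between {0} B d)) = gaussian_binomial q (Suc d) d"
      using card_subspaces_between[of "{0}" B d] B zero_subset_subspace by simp
    ultimately have "real (card {A \<in> F. A \<subseteq> B}) \<le> gaussian_binomial q (Suc d) d" by linarith
    then have "real (card {A \<in> F. A \<subseteq> B}) * (real q - 1) \<le> gaussian_binomial q (Suc d) d * (real q - 1)"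
      using q_ge_2 by (intro mult_right_mono) auto
    then show ?thesis
      using gaussian_binomial_hyperplanes[OF q_ge_2, of d] by simp
  qed
  have le: "real q ^ Suc d - 1 \<le> real q ^ (?n - d) - 1"
    using d q_ge_2 by (intro diff_right_mono power_increasing) auto
  have "real (card F) * (real q ^ (?n - d) - 1) = (\<Sum>A\<in>F. real (card {B \<in> ?S. A \<subseteq> B}) * (real q - 1))"
    using up by simp
  also have "\<dots> = (\<Sum>B\<in>?S. real (card {A \<in> F. A \<subseteq> B}) * (real q - 1))"
    using sum.swap_restrict[of F ?S "\<lambda>_ _. real q - 1" "\<lambda>A B. A \<subseteq> B"] by simp
  also have "\<dots> \<le> (\<Sum>B\<in>?S. real q ^ (?n - d) - 1)"
    using down le by (intro sum_mono) (blast intro: order_trans)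
  also have "\<dots> = real (card ?S) * (real q ^ (?n - d) - 1)" by simp
  finally show ?thesis
    using power_minus_1_pos[OF q_ge_2, of "?n - d"] d by (simp add: mult_le_cancel_right)
qed

text \<open>Members of dimension less than \<open>s\<close> are pushed up level by level through upper shadows, which
  keeps the family Sperner and all intersections of dimension less than \<open>s\<close>. Once all dimensions
  are at least \<open>s\<close>, distinct members share no \<open>s\<close>-dimensional subspace.\<close>

lemma card_sperner_small_intersections_le:
  assumes "d \<le> s" "2 * s \<le> dim UNIV"
    and "\<And>V. V \<in> F \<Longrightarrow> subspace V" "\<And>V. V \<in> F \<Longrightarrow> d \<le> dim V" "sperner_family F"
    and "\<And>V W. V \<in> F \<Longrightarrow> W \<in> F \<Longrightarrow> V \<noteq> W \<Longrightarrow> dim (V \<inter> W) < s"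
  shows "real (card F) \<le> gaussian_binomial q (dim UNIV) s"
  using assms
\<comment> \<open>The induction descends from \<open>d = s\<close>; at level \<open>d\<close> the
  members \<open>F0\<close> of dimension \<open>d\<close> are replaced by their upper shadow
  \<open>S\<close>.\<close>
proof (induction d arbitrary: F rule: inc_induct)
  case base
  have "\<exists>U. subspace U \<and> U \<subseteq> V \<and> dim U = s" if "V \<in> F" for V
    using base that by (metis subspace_of_dim_exists)
  then obtain g where g: "\<And>V. V \<in> F \<Longrightarrow> subspace (g V) \<and> g V \<subseteq> V \<and> dim (g V) = s" by metis
  have "inj_on g F"
  proof (rule inj_onI, rule ccontr)
    fix V W assume VW: "V \<in> F" "W \<in> F" "g V = g W" "V \<noteq> W"
    then have "dim (g V) \<le> dim (V \<inter> W)" using g[of V] g[of W] by (intro dim_subset) auto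
    then show False using base.prems(5)[OF VW(1,2,4)] g[of V] VW by simp
  qed
  moreover have "g ` F \<subseteq> subspaces_between {0} UNIV s"
    using g zero_subset_subspace by (fastforce simp: subspaces_between_def)
  ultimately have "card F \<le> card (subspaces_between {0} UNIV s)"
    by (intro card_inj_on_le) auto
  then show ?case using card_subspaces_between[of "{0}" UNIV s] by (simp del: dim_UNIV)
next
  case (step d)
  note sub = step.prems(2) and ge = step.prems(3) and sperner = step.prems(4)
  define F0 where "F0 = {V \<in> F. dim V = d}"
  define S where "S = {B. subspace B \<and> dim B = Suc d \<and> (\<exists>A\<in>F0. A \<subseteq> B)}"
  have incomparable: "\<not> B \<subseteq> C" "\<not> C \<subseteq> B" if B: "B \<in> S" and C: "C \<in> F - F0" for B C
  proof -
    obtain A where A: "A \<in> F0" "A \<subseteq> B" using B unfolding S_def by blast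
    have AC: "A \<in> F" "C \<in> F" "A \<noteq> C" using A C unfolding F0_def by auto
    then have nsub: "\<not> A \<subseteq> C" using sperner unfolding sperner_family_def by blast
    then show "\<not> B \<subseteq> C" using A by blast
    show "\<not> C \<subseteq> B"
    proof
      assume "C \<subseteq> B"
      moreover have "dim B \<le> dim C" using C ge[of C] B unfolding S_def F0_def by auto
      ultimately have "C = B" using B C sub unfolding S_def by (intro subspace_dim_equal) auto
      then show False using nsub A by blast
    qed
  qed
  have S_S: "\<not> B \<subseteq> C" if "B \<in> S" "C \<in> S" "B \<noteq> C" for B C
    using that subspace_dim_equal[of B C] unfolding S_def by auto
  have subS: "subspace B" "dim B = Suc d" if "B \<in> S" for B using that unfolding S_def by auto
  \<comment> \<open>A proper intersection with \<open>B\<close> has dimension below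
    \<open>Suc d\<close>, which is at most \<open>s\<close>.\<close>
  have int_S: "dim (B \<inter> C) < s" "dim (C \<inter> B) < s" if "B \<in> S" "subspace C" "\<not> B \<subseteq> C" for B C
    using dim_Int_less[of B C] subS[OF that(1)] that step.hyps by (auto simp: Int_commute)
  have "real (card (S \<union> (F - F0))) \<le> gaussian_binomial q (dim UNIV) s"
  proof (rule step.IH)
    fix V W assume VW: "V \<in> S \<union> (F - F0)" "W \<in> S \<union> (F - F0)" "V \<noteq> W"
    show "dim (V \<inter> W) < s"
    proof (cases "V \<in> S")
      case True
      then show ?thesis using VW int_S(1)[of V W] incomparable[of V W] S_S[of V W] subS sub by blast
    next
      case False
      then show ?thesis
        using VW int_S(2)[of W V] incomparable[of W V] sub step.prems(5)[of V W] by blast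
    qed
  next
    fix V assume V: "V \<in> S \<union> (F - F0)"
    then show "subspace V" using subS sub by blast
    show "Suc d \<le> dim V" using V ge[of V] subS(2)[of V] unfolding F0_def by auto
  next
    have "\<not> B \<subseteq> C" if "B \<in> F - F0" "C \<in> F - F0" "B \<noteq> C" for B C
      using that sperner unfolding sperner_family_def by blast
    then show "sperner_family (S \<union> (F - F0))"
      unfolding sperner_family_def using incomparable S_S by (metis Un_iff)
  qed (use step.prems in auto)
  moreover have "card F = card F0 + card (F - F0)"
    unfolding F0_def by (subst card_Un_disjoint[symmetric]) (auto intro: arg_cong[where f = card])
  moreover have "card (S \<union> (F - F0)) = card S + card (F - F0)"
    using incomparable by (intro card_Un_disjoint) auto
  moreover have "card F0 \<le> card S"
    unfolding S_def using sub step.hyps step.prems(1) unfolding F0_def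
    by (intro card_upper_shadow_ge) auto
  ultimately show ?case by linarith
qed

lemma dim_span_singleton: "x \<noteq> 0 \<Longrightarrow> dim (span {x}) = 1"
  by (simp add: dim_insert)

lemma span_singleton_subset_iff: "subspace V \<Longrightarrow> span {x} \<subseteq> V \<longleftrightarrow> x \<in> V"
  using span_minimal[of "{x}" V] span_superset[of "{x}"] by auto

section \<open>Strict bounds: a common vector, size 0 allowed, no common vector\<close>

context
  fixes F L
  assumes sub: "\<And>V. V \<in> F \<Longrightarrow> subspace V"
    and sperner: "sperner_family F" and L: "finite L" "L \<noteq> {}"
    and inter: "\<And>V W. V \<in> F \<Longrightarrow> W \<in> F \<Longrightarrow> V \<noteq> W \<Longrightarrow> dim (V \<inter> W) \<in> L"
begin

text \<open>Taking the line through \<open>x\<close> as \<open>T\<close> lowers the ambient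
  dimension by one; the resulting sum is at most twice \<open>[n - 1, s]\<close>, hence below
  \<open>[n, s]\<close>.\<close>

lemma card_less_if_common_vector:
  assumes "x \<noteq> 0" "\<And>V. V \<in> F \<Longrightarrow> x \<in> V" and n: "2 * card L + 1 \<le> dim UNIV"
  shows "real (card F) < gaussian_binomial q (dim UNIV) (card L)"
proof -
  have s: "1 \<le> card L" using L by (simp add: Suc_le_eq card_gt_0_iff)
  have "real (card F) \<le> (\<Sum>i\<le>card L. gaussian_binomial q (dim UNIV - dim (span {x})) i)"
    using assms sub sperner L inter
    by (intro card_intersecting_family_le) (auto simp: span_singleton_subset_iff)
  also have "\<dots> \<le> 2 * gaussian_binomial q (dim UNIV - 1) (card L)"
    using sum_gaussian_binomial_le[OF q_ge_2, of "card L" 1 "dim UNIV - 1"] n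
      dim_span_singleton[OF assms(1)] by simp
  also have "\<dots> < gaussian_binomial q (dim UNIV) (card L)"
    using gaussian_binomial_double_left[OF q_ge_2, of "card L" "dim UNIV - 1"] n s by simp
  finally show ?thesis .
qed

text \<open>Members of dimension at most \<open>s\<close> cannot meet in dimension \<open>l\<close>, and members through a common
  nonzero vector cannot meet in dimension \<open>0\<close>; in both situations one intersection size is lost.
  The members of dimension at least \<open>s + 1\<close> are counted through their nonzero vectors.\<close>

lemma card_less_if_zero_mem:
  assumes "0 \<in> L" "l \<in> L" "card L \<le> l" and n: "2 * card L + 1 \<le> dim UNIV"
  shows "real (card F) < gaussian_binomial q (dim UNIV) (card L)"
proof -
  define n where "n = dim UNIV"
  define s where "s = card L"
  have s: "1 \<le> s" using L by (simp add: s_def Suc_le_eq card_gt_0_iff)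
  have n2: "2 * s + 1 \<le> n" using n by (simp add: n_def s_def)
  \<comment> \<open>The budget is one third of \<open>?G\<close> for \<open>low\<close> and strictly
    less than two thirds for \<open>high\<close>; both use the constant 4/3 for the sums.\<close>
  define low where "low = {V \<in> F. dim V \<le> s}"
  define high where "high = {V \<in> F. s < dim V}"
  let ?G = "gaussian_binomial q n s"
  have "real (card low) \<le> (\<Sum>i\<le>card (L - {l}). gaussian_binomial q (dim UNIV - dim {0}) i)"
  proof (rule card_intersecting_family_le)
    fix V W assume VW: "V \<in> low" "W \<in> low" "V \<noteq> W"
    then have "dim (V \<inter> W) < dim V"
      using sperner sub by (intro dim_Int_less) (auto simp: low_def sperner_family_def)
    then show "dim (V \<inter> W) \<in> L - {l}"
      using VW inter assms unfolding low_def s_def by auto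
  qed (use sub L sperner zero_subset_subspace sperner_family_subset[of F low] in \<open>auto simp: low_def\<close>)
  then have "real (card low) \<le> (\<Sum>i\<le>s - 1. gaussian_binomial q n i)"
    using assms L by (simp add: n_def s_def)
  moreover have "2 * (s - 1) + 2 \<le> n + 1" using n2 by linarith
  ultimately have "3 * real (card low) \<le> 4 * gaussian_binomial q n (s - 1)"
    using sum_gaussian_binomial_le[OF q_ge_2, of "s - 1" 2 n] by simp
  also have "\<dots> \<le> ?G"
    using gaussian_binomial_ratio[OF q_ge_2, of "s - 1" 2 n] n2 s by simp
  finally have low: "3 * real (card low) \<le> ?G" .

  have deg: "3 * real (card {V \<in> high. x \<in> V}) \<le> 4 * gaussian_binomial q (n - 1) (s - 1)" if "x \<noteq> 0" for x
  proof -
    have "real (card {V \<in> high. x \<in> V}) \<le>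
      (\<Sum>i\<le>card (L - {0}). gaussian_binomial q (dim UNIV - dim (span {x})) i)"
    proof (rule card_intersecting_family_le)
      fix V W assume VW: "V \<in> {V \<in> high. x \<in> V}" "W \<in> {V \<in> high. x \<in> V}" "V \<noteq> W"
      then have "x \<in> V \<inter> W" by simp
      then have "dim (V \<inter> W) \<noteq> 0" using that by auto
      then show "dim (V \<inter> W) \<in> L - {0}"
        using VW inter unfolding high_def by auto
    qed (use sub L sperner sperner_family_subset[of F "{V \<in> high. x \<in> V}"] in
        \<open>auto simp: high_def span_singleton_subset_iff\<close>)
    then have "real (card {V \<in> high. x \<in> V}) \<le> (\<Sum>i\<le>s - 1. gaussian_binomial q (n - 1) i)"
      using assms L dim_span_singleton[OF that] by (simp add: n_def s_def del: dim_span)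
    moreover have "2 * (s - 1) + 2 \<le> n - 1 + 1" using n2 s by linarith
    from sum_gaussian_binomial_le[OF q_ge_2 this]
    have "3 * (\<Sum>i\<le>s - 1. gaussian_binomial q (n - 1) i) \<le> 4 * gaussian_binomial q (n - 1) (s - 1)"
      by simp
    ultimately show ?thesis by linarith
  qed
  have card_nonzero: "real (card (V - {0})) = real q ^ dim V - 1" if "subspace V" for V
    using that card_subspace[OF that] subspace_0[OF that] q_ge_2 by (simp add: of_nat_diff)
  have "3 * (real (card high) * (real q ^ Suc s - 1)) = (\<Sum>V\<in>high. 3 * (real q ^ Suc s - 1))"
    by simp
  also have "\<dots> \<le> (\<Sum>V\<in>high. 3 * real (card {x \<in> UNIV - {0}. x \<in> V}))"
  proof (rule sum_mono)
    fix V assume V: "V \<in> high"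
    have "{x \<in> UNIV - {0}. x \<in> V} = V - {0}" by auto
    moreover have "real q ^ Suc s \<le> real q ^ dim V"
      using V q_ge_2 by (intro power_increasing) (auto simp: high_def)
    ultimately show "3 * (real q ^ Suc s - 1) \<le> 3 * real (card {x \<in> UNIV - {0}. x \<in> V})"
      using card_nonzero[of V] V sub by (simp add: high_def)
  qed
  also have "\<dots> = (\<Sum>x\<in>UNIV - {0}. 3 * real (card {V \<in> high. x \<in> V}))"
    using sum.swap_restrict[of high "UNIV - {0}" "\<lambda>_ _. 3::real" "\<lambda>V x. x \<in> V"]
    by (simp add: mult.commute)
  also have "\<dots> \<le> (\<Sum>x\<in>UNIV - {0::'v}. 4 * gaussian_binomial q (n - 1) (s - 1))"
    using deg by (intro sum_mono) auto
  also have "\<dots> = 4 * ((real q ^ n - 1) * gaussian_binomial q (n - 1) (s - 1))"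
    using card_nonzero[of UNIV] by (simp add: n_def del: dim_UNIV)
  \<comment> \<open>Absorption produces \<open>?G\<close>; the constant 4 is split so that one
    factor 2 is beaten by the extra power of \<open>q\<close> from
    \<open>dim V \<ge> Suc s\<close>.\<close>
  also have "\<dots> = 2 * ?G * (2 * (real q ^ s - 1))"
    using gaussian_binomial_Suc_Suc[OF q_ge_2, of "n - 1" "s - 1"] n2 s by (simp add: algebra_simps)
  also have "\<dots> < 2 * ?G * (real q ^ Suc s - 1)"
  proof (rule mult_strict_left_mono)
    have "2 * real q ^ s \<le> real q * real q ^ s" using q_ge_2 by (intro mult_right_mono) auto
    then show "2 * (real q ^ s - 1) < real q ^ Suc s - 1" by simp
    show "0 < 2 * ?G" using gaussian_binomial_ge_1[OF q_ge_2, of s n] n2 by simp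
  qed
  finally have "3 * real (card high) * (real q ^ Suc s - 1) < 2 * ?G * (real q ^ Suc s - 1)"
    by (simp only: mult.assoc)
  then have "3 * real (card high) < 2 * ?G"
    using power_minus_1_pos[OF q_ge_2, of "Suc s"] by (simp only: mult_less_cancel_right_pos)
  moreover have "card F = card low + card high"
    unfolding low_def high_def
    by (subst card_Un_disjoint[symmetric]) (auto intro: arg_cong[where f = card])
  ultimately show ?thesis using low unfolding n_def s_def by linarith
qed

text \<open>Each member contains an \<open>a\<close>-dimensional subspace \<open>T\<close> of a fixed member \<open>V\<^sub>1\<close>, and, by the choice of
  a member \<open>G T\<close> not containing \<open>T\<close>, also a vector of \<open>G T\<close> outside \<open>T\<close>. So few subspaces of
  dimension \<open>a + 1\<close> suffice to have one inside every member.\<close>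

lemma card_less_if_no_common_vector:
  assumes "F \<noteq> {}" "a \<in> L" "1 \<le> a" "a \<le> dim UNIV"
    and L_bounds: "\<And>l. l \<in> L \<Longrightarrow> a \<le> l \<and> l < k"
    and dims: "\<And>V. V \<in> F \<Longrightarrow> a \<le> dim V \<and> dim V \<le> k"
    and no_common: "\<And>x. x \<noteq> 0 \<Longrightarrow> \<exists>V\<in>F. x \<notin> V"
    and large: "(real q ^ card L - 1) * gaussian_binomial q (k\<^sup>2) (a + 1) \<le> real q ^ (dim UNIV - a) - 1"
  shows "real (card F) < gaussian_binomial q (dim UNIV) (card L)"
proof -
  obtain V1 where V1: "V1 \<in> F" using assms by blast
  \<comment> \<open>The implication makes the choice function \<open>G\<close> total. A subspace of
    dimension \<open>a \<ge> 1\<close> has a nonzero vector, and some member misses it.\<close>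
  have "\<exists>V\<in>F. subspace T \<and> dim T = a \<longrightarrow> \<not> T \<subseteq> V" for T
  proof (cases "subspace T \<and> dim T = a")
    case True
    then have "\<not> T \<subseteq> {0}" using dim_eq_0[of T] \<open>1 \<le> a\<close> by auto
    then obtain x where "x \<in> T" "x \<noteq> 0" by blast
    then show ?thesis using no_common[of x] by blast
  qed (use V1 in blast)
  then obtain G where G: "\<And>T. G T \<in> F"
    "\<And>T. subspace T \<Longrightarrow> dim T = a \<Longrightarrow> \<not> T \<subseteq> G T" by metis
  \<comment> \<open>Tuples \<open>xs\<close> encode spanning sets of \<open>T\<close>, which makes
    counting easy: at most \<open>q ^ (k * a)\<close> tuples with \<open>q ^ k\<close> choices of
    \<open>y\<close> each. Degenerate choices are discarded in \<open>C\<close> by the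
    dimension.\<close>
  define I where "I = (SIGMA xs:{xs. set xs \<subseteq> V1 \<and> length xs = a}. G (span (set xs)))"
  define C where "C = {U \<in> (\<lambda>(xs, y). span (insert y (set xs))) ` I. dim U = a + 1}"
  have card_V: "card V \<le> q ^ k" if "V \<in> F" for V
    using that dims[of V] card_subspace[of V] sub q_ge_2 by (simp add: power_increasing)
  have finI: "finite I"
    unfolding I_def by (intro finite_SigmaI finite_lists_length_eq) auto
  have "card I = (\<Sum>xs\<in>{xs. set xs \<subseteq> V1 \<and> length xs = a}. card (G (span (set xs))))"
    unfolding I_def by (intro card_SigmaI finite_lists_length_eq) auto
  also have "\<dots> \<le> (\<Sum>xs\<in>{xs. set xs \<subseteq> V1 \<and> length xs = a}. q ^ k)"
    using card_V G(1) by (intro sum_mono) auto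
  also have "\<dots> = card V1 ^ a * q ^ k" by (simp add: card_lists_length_eq)
  also have "\<dots> \<le> (q ^ k) ^ a * q ^ k" using card_V[OF V1] by (intro mult_right_mono power_mono) auto
  also have "\<dots> = q ^ (k * (a + 1))" by (simp add: power_add power_mult mult.commute[of "(q ^ k) ^ a"])
  finally have cardI: "card I \<le> q ^ (k * (a + 1))" .
  have "card C \<le> card ((\<lambda>(xs, y). span (insert y (set xs))) ` I)"
    unfolding C_def by (intro card_mono) auto
  also have "\<dots> \<le> card I" using finI by (rule card_image_le)
  finally have cardC: "card C \<le> q ^ (k * (a + 1))" using cardI by linarith

  have cover: "\<exists>U\<in>C. U \<subseteq> V" if V: "V \<in> F" for V
  proof -
    have ge_a: "a \<le> dim (V \<inter> W)" if "W \<in> F" for W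
      using V that inter[of V W] L_bounds dims by (cases "V = W") auto
    have subVW: "subspace (V \<inter> W)" if "W \<in> F" for W
      using V that sub by (intro subspace_inter) auto
    obtain T where T: "subspace T" "T \<subseteq> V \<inter> V1" "dim T = a"
      using subspace_of_dim_exists[OF subVW[OF V1] ge_a[OF V1]] .
    obtain B where B: "finite B" "B \<subseteq> T" "independent B" "span B = T" "card B = a"
      using basis_subspace_exists[OF T(1)] T(3) by metis
    obtain xs where xs: "set xs = B" "distinct xs" using finite_distinct_list[OF B(1)] by blast
    have len: "length xs = a" using xs B distinct_card by fastforce
    \<comment> \<open>The intersection has dimension at least \<open>a = dim T\<close>, so inclusion
      would force equality and put \<open>T\<close> inside \<open>G T\<close>.\<close>
    have "\<not> V \<inter> G T \<subseteq> T"
    proof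
      assume "V \<inter> G T \<subseteq> T"
      then have "V \<inter> G T = T"
        using subspace_dim_equal[OF subVW[OF G(1)] T(1)] ge_a[OF G(1)] T by auto
      then show False using G(2)[OF T(1,3)] by blast
    qed
    then obtain y where y: "y \<in> V" "y \<in> G T" "y \<notin> T" by blast
    have "dim (insert y B) = a + 1" using y B T by (metis dim_insert dim_span)
    moreover have "(xs, y) \<in> I" using xs len B T y unfolding I_def by auto
    moreover have "span (insert y B) \<subseteq> V"
      using y B T sub[OF V] span_insert_subset_iff[of V y B] by blast
    ultimately show ?thesis using xs
      unfolding C_def by (intro bexI[of _ "span (insert y B)"]) (auto intro!: image_eqI[of _ _ "(xs, y)"])
  qed
  have fibre: "real (card {V \<in> F. U \<subseteq> V}) \<le>
    (\<Sum>i\<le>card L - 1. gaussian_binomial q (dim UNIV - (a + 1)) i)" if U: "U \<in> C" for U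
  proof -
    have dU: "dim U = a + 1" "subspace U" using U unfolding C_def by auto
    have "real (card {V \<in> F. U \<subseteq> V}) \<le> (\<Sum>i\<le>card (L - {a}). gaussian_binomial q (dim UNIV - dim U) i)"
    proof (rule card_intersecting_family_le)
      fix V W assume VW: "V \<in> {V \<in> F. U \<subseteq> V}" "W \<in> {V \<in> F. U \<subseteq> V}" "V \<noteq> W"
      then have "dim U \<le> dim (V \<inter> W)" by (intro dim_subset) auto
      then show "dim (V \<inter> W) \<in> L - {a}" using VW inter dU by auto
    qed (use sub L sperner dU sperner_family_subset[of F "{V \<in> F. U \<subseteq> V}"] in auto)
    then show ?thesis using dU L \<open>a \<in> L\<close> by simp
  qed
  have "F = (\<Union>U\<in>C. {V \<in> F. U \<subseteq> V})" using cover by blast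
  then have "card F \<le> (\<Sum>U\<in>C. card {V \<in> F. U \<subseteq> V})"
    by (metis card_UN_le finite_vector_sets)
  then have "real (card F) \<le> (\<Sum>U\<in>C. real (card {V \<in> F. U \<subseteq> V}))"
    by (metis of_nat_le_iff of_nat_sum)
  also have "\<dots> \<le> (\<Sum>U\<in>C. \<Sum>i\<le>card L - 1. gaussian_binomial q (dim UNIV - (a + 1)) i)"
    using fibre by (rule sum_mono)
  also have "\<dots> \<le> real q ^ (k * (a + 1)) * (\<Sum>i\<le>card L - 1. gaussian_binomial q (dim UNIV - (a + 1)) i)"
    using cardC gaussian_binomial_nonneg[OF q_ge_2] unfolding sum_constant
    by (intro mult_right_mono sum_nonneg) (auto simp flip: of_nat_power)
  also have "\<dots> < gaussian_binomial q (dim UNIV) (card L)"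
  proof (rule cover_count_less_gaussian_binomial[OF q_ge_2 \<open>1 \<le> a\<close> _ _ _ \<open>a \<le> dim UNIV\<close> large])
    show "a < k" using L_bounds \<open>a \<in> L\<close> by blast
    show "1 \<le> card L" using L by (simp add: Suc_le_eq card_gt_0_iff)
    \<comment> \<open>All sizes lie in an interval of length \<open>k - a\<close>, which gives the
      required bound on \<open>card L\<close>.\<close>
    have "card L \<le> card {a..<k}" using L_bounds by (intro card_mono) auto
    then show "card L \<le> k - a" by simp
  qed
  finally show ?thesis .
qed

end
end

section \<open>Case distinction on the intersection sizes\<close>

theorem theorem1p16:
  fixes scale :: "'f::{field,finite} \<Rightarrow> 'v::ab_group_add \<Rightarrow> 'v"
    and Basis :: "'v set"
    and \<V> :: "'v set set"
    and l :: "nat \<Rightarrow> nat"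
    and L :: "nat set"
    and q n s k :: nat
  assumes q: "q = card (UNIV :: 'f set)"
    and space: "finite_dimensional_vector_space scale Basis"
    and n: "vector_space.dim scale (UNIV :: 'v set) = n"
    and s: "s \<ge> 1"
    and l: "strict_mono_on {1..s} l"
    and L: "L = l ` {1..s}"
    and subspaces: "\<And>V. V \<in> \<V> \<Longrightarrow> module.subspace scale V"
    and sperner: "sperner_family \<V>"
    and intersecting:
      "\<And>V W. V \<in> \<V> \<Longrightarrow> W \<in> \<V> \<Longrightarrow> V \<noteq> W \<Longrightarrow> vector_space.dim scale (V \<inter> W) \<in> L"
    and k: "k = Max (vector_space.dim scale ` \<V>)"
    and n_large: "real n \<ge> max (log (real q)
        ((real q ^ s - 1) * gaussian_binomial q (k\<^sup>2) (l 1 + 1) + 1) + real (l 1)) (2 * real s + 1)"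
  shows "real (card \<V>) \<le> gaussian_binomial q n s \<and>
    (real (card \<V>) = gaussian_binomial q n s \<longrightarrow> L = {0..<s})"
proof -
  interpret finite_dimensional_vector_space scale Basis by (rule space)
  interpret finite_field_vector_space scale Basis q by unfold_locales (rule q)
  have n2: "2 * s + 1 \<le> n" using n_large by simp
  have finL: "finite L" and cardL: "card L = s" and neL: "L \<noteq> {}"
    using L s strict_mono_on_imp_inj_on[OF l] by (auto simp: card_image)
  have l1: "l 1 \<in> L" using L s by simp
  have l1_le: "l 1 \<le> x" if "x \<in> L" for x
    using that L s strict_mono_on_leD[OF l] by force
  \<comment> \<open>The first case includes the empty family, whose \<open>Max\<close> is
    unspecified. In the first and third cases the bound is strict, so the equality clause is
    vacuous.\<close>
  consider "card \<V> \<le> 1" | "L \<subseteq> {0..<s}" | "\<not> card \<V> \<le> 1" "\<not> L \<subseteq> {0..<s}" by blast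
  then show ?thesis
  proof cases
    case 1
    have "2 * gaussian_binomial q (n - 1) s < gaussian_binomial q n s"
      using gaussian_binomial_double_left[OF q_ge_2, of s "n - 1"] s n2 by simp
    moreover have "1 \<le> gaussian_binomial q (n - 1) s"
      using gaussian_binomial_ge_1[OF q_ge_2, of s "n - 1"] n2 by simp
    ultimately show ?thesis using 1 by linarith
  next
    case 2
    have "L = {0..<s}" using 2 cardL by (intro card_subset_eq) auto
    moreover have "real (card \<V>) \<le> gaussian_binomial q (dim UNIV) s"
    proof (rule card_sperner_small_intersections_le[of 0])
      show "dim (V \<inter> W) < s" if "V \<in> \<V>" "W \<in> \<V>" "V \<noteq> W" for V W
        using intersecting[OF that] 2 by auto
    qed (use n n2 subspaces sperner in auto)
    ultimately show ?thesis using n by simp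
  next
    case 3
    then obtain x where x: "x \<in> L" "s \<le> x" by (meson atLeastLessThan_iff le0 not_le subsetI)
    have "real (card \<V>) < gaussian_binomial q n s"
    proof (cases "l 1 = 0")
      case True
      then show ?thesis
        using card_less_if_zero_mem[of \<V> L x] subspaces sperner finL neL intersecting l1 x n n2 cardL
        by simp
    next
      case False
      show ?thesis
      proof (cases "\<exists>x. x \<noteq> 0 \<and> (\<forall>V\<in>\<V>. x \<in> V)")
        case True
        then obtain x where "x \<noteq> 0" "\<forall>V\<in>\<V>. x \<in> V" by blast
        then show ?thesis
          using card_less_if_common_vector[of \<V> L x] subspaces sperner finL neL intersecting n n2 cardL
          by simp
      next
        case no_common: False
        have k_ge: "dim V \<le> k" if "V \<in> \<V>" for V
          unfolding k using that by (intro Max_ge) auto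
        have less_k: "dim (V \<inter> W) < k" if "V \<in> \<V>" "W \<in> \<V>" "V \<noteq> W" for V W
        proof -
          have "dim (V \<inter> W) < dim V"
            using that sperner subspaces by (intro dim_Int_less) (auto simp: sperner_family_def)
          then show ?thesis using k_ge[OF that(1)] by linarith
        qed
        obtain A B where AB: "A \<in> \<V>" "B \<in> \<V>" "A \<noteq> B"
          using 3(1) card_le_Suc0_iff_eq[of \<V>] by auto
        have l1_k: "l 1 < k" using less_k[OF AB] l1_le[OF intersecting[OF AB]] by linarith
        have dim_ge: "l 1 \<le> dim V" if V: "V \<in> \<V>" for V
        proof -
          obtain W where W: "W \<in> \<V>" "V \<noteq> W" using AB by metis
          show ?thesis
            using l1_le[OF intersecting[OF V W]] dim_subset[of "V \<inter> W" V] by simp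
        qed
        \<comment> \<open>Distinct members meet in dimension below \<open>k\<close>, so sizes from
          \<open>k\<close> on never occur. Dropping them meets the requirement of sizes below
          \<open>k\<close>; monotonicity in the lower index then returns from \<open>card L0\<close>
          to \<open>s\<close>.\<close>
        define L0 where "L0 = L \<inter> {..<k}"
        have L0: "card L0 \<le> s" "l 1 \<in> L0" "finite L0"
          using cardL finL l1 l1_k card_mono[of L L0] by (auto simp: L0_def)
        let ?K = "gaussian_binomial q (k\<^sup>2) (l 1 + 1)"
        have K: "?K \<ge> 0" by (rule gaussian_binomial_nonneg[OF q_ge_2])
        have q1: "real q > 1" using q_ge_2 by simp
        have "real q ^ s \<ge> 1" using q1 by simp
        \<comment> \<open>The logarithm is therefore nonnegative, which gives
          \<open>l 1 \<le> n\<close>; only then does the natural subtraction \<open>n - l 1\<close>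
          agree with the real one.\<close>
        then have pos: "(real q ^ s - 1) * ?K + 1 \<ge> 1" using K by simp
        then have "log (real q) ((real q ^ s - 1) * ?K + 1) \<ge> 0" using q1 by simp
        then have "real (l 1) \<le> real n" using n_large by simp
        then have l1_n: "l 1 \<le> n" by simp
        have "log (real q) ((real q ^ s - 1) * ?K + 1) \<le> real (n - l 1)"
          using n_large l1_n by simp
        then have "(real q ^ s - 1) * ?K + 1 \<le> real q ^ (n - l 1)"
          using q1 pos by (simp add: log_le_iff powr_realpow)
        moreover have "(real q ^ card L0 - 1) * ?K \<le> (real q ^ s - 1) * ?K"
          using L0 K q1 by (intro mult_right_mono diff_right_mono power_increasing) auto
        ultimately have large: "(real q ^ card L0 - 1) * ?K \<le> real q ^ (dim UNIV - l 1) - 1"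
          unfolding n by linarith
        have "real (card \<V>) < gaussian_binomial q (dim UNIV) (card L0)"
        proof (rule card_less_if_no_common_vector[where a = "l 1" and k = k])
          show "dim (V \<inter> W) \<in> L0" if "V \<in> \<V>" "W \<in> \<V>" "V \<noteq> W" for V W
            using that intersecting less_k by (simp add: L0_def)
          show "l 1 \<le> y \<and> y < k" if "y \<in> L0" for y
            using that l1_le by (simp add: L0_def)
          show "l 1 \<le> dim UNIV" using l1_n n by simp
          show "\<exists>V\<in>\<V>. y \<notin> V" if "y \<noteq> 0" for y using that no_common by blast
        qed (use subspaces sperner L0 AB False dim_ge k_ge large in auto)
        also have "\<dots> \<le> gaussian_binomial q n s"
          unfolding n using L0 n2 by (intro gaussian_binomial_mono_right[OF q_ge_2]) auto
        finally show ?thesis .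
      qed
    qed
    then show ?thesis by simp
  qed
qed

end
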